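(* Let $F:\mathbb{R}^d\to\mathbb{R}^d$ and $g_1,\dots,g_m:\mathbb{R}^d\to\mathbb{R}$ satisfy the standing assumptions (A1) and (A2) of the context, and let $F$ be monotone. Let $R\ge D$ be a known upper bound. Then there are constants $C_1,C_2,C_3$, depending on $R$, $L_F$, $L_g$ and $\ell_g$ but not on $T$, such that Algorithm Parameter-Free OPCGM (described in the context) achieves, for all $T\ge2$ and all $x\in\mathcal{C}$, $$F(x)^\top(\bar x_T-x)\le\frac{C_1}{\sqrt T},\qquad \max_{i\in[m]}g_i(\bar x_T)\le C_2+\frac{C_3}{\sqrt T}.$$
   Context: $\|\cdot\|$ is the Euclidean norm, $[m]=\{1,\dots,m\}$, $\mathcal{C}=\{x\in\mathbb{R}^d: g_i(x)\le0,\ i\in[m]\}$, $I_x=\{i\in[m]: g_i(x)\ge0\}$. $F$ is monotone if $(F(x)-F(y))^\top(x-y)\ge0$ for all $x,y$. (A1) $F$ is maximal monotone and continuous on $\mathbb{R}^d$, and $L_F:=\sup_{\|x\|\le R}\|F(x)\|<\infty$. (A2) Each $g_i$ is convex, $L_g$-Lipschitz and $\ell_g$-smooth (differentiable with $\ell_g$-Lipschitz gradient) on $\mathbb{R}^d$. The set $\mathcal{C}$ is nonempty and contained in the Euclidean ball of radius $D$ centered at the origin. There is at least one constraint $g_{i^*}$ and $\ell_0>0$ with $\nabla^2g_{i^*}(x)\succeq\ell_0I$ for all $x$ in a neighborhood of $\partial\mathcal{C}$. Algorithm Parameter-Free OPCGM. Input $x_0\in\mathcal{C}$, radius bound $R\ge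 D$, horizon $T\ge1$. For $t=0,\dots,T-1$: set $\eta_t=\alpha_t=1/\sqrt{t+1}$ and $V_t=4\|F(x_t)\|+2\alpha_tR+1$; let $$\widetilde{\mathcal V}_{\alpha_t}(x_t)=\{v\in\mathbb{R}^d:\ \alpha_tg_i(x_t)+\nabla g_i(x_t)^\top v\le0\ \forall i\in I_{x_t},\ \|v\|\le V_t\};$$ compute an approximate minimizer $v_t\in\widetilde{\mathcal V}_{\alpha_t}(x_t)$ of $\frac12\|v+F(x_t)\|^2$ over this set with precision $\epsilon_{\mathrm{QP}}\le\|F(x_t)\|^2/(t+1)$, meaning $(v_t+F(x_t))^\top(v_t-w)\le\epsilon_{\mathrm{QP}}/2$ for all $w\in\widetilde{\mathcal V}_{\alpha_t}(x_t)$; set $y_{t+1}=x_t+\eta_tv_t$ and $x_{t+1}=\min\{1,R/\|y_{t+1}\|\}\,y_{t+1}$. Output $\bar x_T=\frac1T\sum_{t=0}^{T-1}x_t$. *)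

theory Defs
  imports "HOL-Analysis.Analysis" "HOL-Library.Poly_Mapping"
begin

section \<open>Euclidean spaces with the dimension as a number\<close>

text \<open>
  The constants of the theorem must not depend on the dimension \<open>d\<close>, so \<open>d\<close> has to be quantified
  inside an existential quantifier and cannot be a type. Finitely supported sequences carry the
  usual inner product, and the \<open>d\<close>-dimensional Euclidean space is the subspace of the
  sequences supported in \<open>{..<d}\<close>. Norm, Lipschitz continuity, convexity, derivatives and so on
  are then the library notions on, or within, this subspace.
\<close>

instantiation poly_mapping :: (type, real_vector) real_vector
begin

definition scaleR_poly_mapping :: "real \<Rightarrow> ('a \<Rightarrow>\<^sub>0 'b) \<Rightarrow> ('a \<Rightarrow>\<^sub>0 'b)"
  where "scaleR_poly_mapping r f = Poly_Mapping.map (scaleR r) f"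

lemma lookup_scaleR: "Poly_Mapping.lookup (r *\<^sub>R f) k = r *\<^sub>R Poly_Mapping.lookup f k"
  for f :: "'a \<Rightarrow>\<^sub>0 'b"
  unfolding scaleR_poly_mapping_def by transfer (simp add: when_def)

instance
  by standard (auto intro!: poly_mapping_eqI simp: lookup_scaleR lookup_add algebra_simps)

end

instantiation poly_mapping :: (type, real_inner) real_inner
begin

definition inner_poly_mapping :: "('a \<Rightarrow>\<^sub>0 'b) \<Rightarrow> ('a \<Rightarrow>\<^sub>0 'b) \<Rightarrow> real"
  where "inner_poly_mapping f g
    = (\<Sum>k\<in>Poly_Mapping.keys f \<union> Poly_Mapping.keys g.
         Poly_Mapping.lookup f k \<bullet> Poly_Mapping.lookup g k)"

definition norm_poly_mapping :: "('a \<Rightarrow>\<^sub>0 'b) \<Rightarrow> real"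
  where "norm_poly_mapping f = sqrt (f \<bullet> f)"

definition sgn_poly_mapping :: "('a \<Rightarrow>\<^sub>0 'b) \<Rightarrow> ('a \<Rightarrow>\<^sub>0 'b)"
  where "sgn_poly_mapping f = f /\<^sub>R norm f"

definition dist_poly_mapping :: "('a \<Rightarrow>\<^sub>0 'b) \<Rightarrow> ('a \<Rightarrow>\<^sub>0 'b) \<Rightarrow> real"
  where "dist_poly_mapping f g = norm (f - g)"

definition uniformity_poly_mapping :: "(('a \<Rightarrow>\<^sub>0 'b) \<times> ('a \<Rightarrow>\<^sub>0 'b)) filter"
  where "uniformity_poly_mapping
    = (INF e\<in>{0<..}. principal {(f, g). dist f g < e})"

definition open_poly_mapping :: "('a \<Rightarrow>\<^sub>0 'b) set \<Rightarrow> bool"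
  where "open_poly_mapping U
    \<longleftrightarrow> (\<forall>f\<in>U. eventually (\<lambda>(f', g). f' = f \<longrightarrow> g \<in> U) uniformity)"

lemma inner_poly_mapping_superset:
  fixes f g :: "'a \<Rightarrow>\<^sub>0 'b"
  assumes "finite S" "Poly_Mapping.keys f \<union> Poly_Mapping.keys g \<subseteq> S"
  shows "f \<bullet> g = (\<Sum>k\<in>S. Poly_Mapping.lookup f k \<bullet> Poly_Mapping.lookup g k)"
  unfolding inner_poly_mapping_def
  by (rule sum.mono_neutral_left) (use assms in \<open>auto simp: in_keys_iff\<close>)

instance
proof
  fix f g h :: "'a \<Rightarrow>\<^sub>0 'b" and r :: real
  show "f \<bullet> g = g \<bullet> f"
    by (simp add: inner_poly_mapping_def inner_commute Un_commute)
  let ?S = "Poly_Mapping.keys f \<union> Poly_Mapping.keys g \<union> Poly_Mapping.keys h"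
  have "Poly_Mapping.keys (f + g) \<subseteq> ?S"
    using keys_add by fastforce
  then have "(f + g) \<bullet> h = (\<Sum>k\<in>?S. Poly_Mapping.lookup (f + g) k \<bullet> Poly_Mapping.lookup h k)"
    by (intro inner_poly_mapping_superset) auto
  moreover have "f \<bullet> h = (\<Sum>k\<in>?S. Poly_Mapping.lookup f k \<bullet> Poly_Mapping.lookup h k)"
    by (rule inner_poly_mapping_superset) auto
  moreover have "g \<bullet> h = (\<Sum>k\<in>?S. Poly_Mapping.lookup g k \<bullet> Poly_Mapping.lookup h k)"
    by (rule inner_poly_mapping_superset) auto
  ultimately show "(f + g) \<bullet> h = f \<bullet> h + g \<bullet> h"
    by (simp add: lookup_add inner_add_left sum.distrib)
  have "Poly_Mapping.keys (r *\<^sub>R f) \<subseteq> Poly_Mapping.keys f"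
    by (auto simp: in_keys_iff lookup_scaleR)
  then have "(r *\<^sub>R f) \<bullet> g = (\<Sum>k\<in>Poly_Mapping.keys f \<union> Poly_Mapping.keys g.
      Poly_Mapping.lookup (r *\<^sub>R f) k \<bullet> Poly_Mapping.lookup g k)"
    by (intro inner_poly_mapping_superset) auto
  then show "(r *\<^sub>R f) \<bullet> g = r * (f \<bullet> g)"
    by (simp add: inner_poly_mapping_def lookup_scaleR sum_distrib_left)
  show "0 \<le> f \<bullet> f"
    by (simp add: inner_poly_mapping_def sum_nonneg)
  show "f \<bullet> f = 0 \<longleftrightarrow> f = 0"
    by (auto simp: inner_poly_mapping_def sum_nonneg_eq_0_iff in_keys_iff
             intro!: poly_mapping_eqI)
qed (simp_all add: norm_poly_mapping_def sgn_poly_mapping_def dist_poly_mapping_def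
       uniformity_poly_mapping_def open_poly_mapping_def)

end

type_synonym seq = "nat \<Rightarrow>\<^sub>0 real"

definition Rn :: "nat \<Rightarrow> seq set"
  where "Rn d = {x. Poly_Mapping.keys x \<subseteq> {..<d}}"

lemma inner_Rn:
  "x \<in> Rn d \<Longrightarrow> y \<in> Rn d \<Longrightarrow>
    x \<bullet> y = (\<Sum>k<d. Poly_Mapping.lookup x k * Poly_Mapping.lookup y k)"
  unfolding Rn_def by (subst inner_poly_mapping_superset[of "{..<d}"]) auto

lemma norm_Rn: "x \<in> Rn d \<Longrightarrow> norm x = sqrt (\<Sum>k<d. (Poly_Mapping.lookup x k)\<^sup>2)"
  by (simp add: norm_poly_mapping_def inner_Rn power2_eq_square)

lemma subspace_Rn: "subspace (Rn d)"
  unfolding subspace_def Rn_def mem_Collect_eq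
proof (intro conjI ballI allI)
  fix x y :: seq
  assume "x \<in> {x. Poly_Mapping.keys x \<subseteq> {..<d}}" "y \<in> {x. Poly_Mapping.keys x \<subseteq> {..<d}}"
  then show "Poly_Mapping.keys (x + y) \<subseteq> {..<d}"
    using keys_add[of x y] by auto
qed (auto simp: subset_iff in_keys_iff lookup_scaleR)


section \<open>Monotone operators\<close>

text \<open>Operators are identified with their graphs, which may be multivalued; this is needed to
  speak about maximality.\<close>

definition monotone_graph :: "(seq \<times> seq) set \<Rightarrow> bool"
  where "monotone_graph A \<longleftrightarrow> (\<forall>(x, u)\<in>A. \<forall>(y, v)\<in>A. (u - v) \<bullet> (x - y) \<ge> 0)"

definition maximal_monotone_graph :: "nat \<Rightarrow> (seq \<times> seq) set \<Rightarrow> bool"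
  where "maximal_monotone_graph d A \<longleftrightarrow>
    A \<subseteq> Rn d \<times> Rn d \<and> monotone_graph A \<and>
    (\<forall>B. B \<subseteq> Rn d \<times> Rn d \<and> monotone_graph B \<and> A \<subseteq> B \<longrightarrow> B = A)"

definition monotone_operator :: "nat \<Rightarrow> (seq \<Rightarrow> seq) \<Rightarrow> bool"
  where "monotone_operator d F \<longleftrightarrow> (\<forall>x\<in>Rn d. \<forall>y\<in>Rn d. (F x - F y) \<bullet> (x - y) \<ge> 0)"

definition maximal_monotone_operator :: "nat \<Rightarrow> (seq \<Rightarrow> seq) \<Rightarrow> bool"
  where "maximal_monotone_operator d F \<longleftrightarrow> maximal_monotone_graph d ((\<lambda>x. (x, F x)) ` Rn d)"


section \<open>Gradient and Hessian\<close>

text \<open>Requiring \<open>p \<in> Rn d\<close> makes the gradient unique: derivatives within \<open>Rn d\<close> only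
  see directions in \<open>Rn d\<close>.\<close>

definition has_gradient :: "nat \<Rightarrow> (seq \<Rightarrow> real) \<Rightarrow> seq \<Rightarrow> seq \<Rightarrow> bool"
  where "has_gradient d f x p \<longleftrightarrow>
    p \<in> Rn d \<and> (f has_derivative (\<lambda>h. p \<bullet> h)) (at x within Rn d)"

definition gradient :: "nat \<Rightarrow> (seq \<Rightarrow> real) \<Rightarrow> seq \<Rightarrow> seq"
  where "gradient d f x = (THE p. has_gradient d f x p)"

lemma has_gradient_unique:
  assumes "x \<in> Rn d" "has_gradient d f x p" "has_gradient d f x q"
  shows "p = q"
proof -
  have *: "((\<lambda>t. f (x + t *\<^sub>R h)) has_real_derivative r \<bullet> h) (at 0)"
    if "has_gradient d f x r" "h \<in> Rn d" for r h
  proof -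
    have img: "range (\<lambda>t. x + t *\<^sub>R h) \<subseteq> Rn d"
      using assms(1) that(2) subspace_Rn by (auto intro!: subspace_add subspace_scale)
    have "(f has_derivative (\<lambda>h. r \<bullet> h)) (at (x + 0 *\<^sub>R h) within range (\<lambda>t. x + t *\<^sub>R h))"
      using that(1) img by (auto simp: has_gradient_def intro: has_derivative_subset)
    moreover have "((\<lambda>t. x + t *\<^sub>R h) has_derivative (\<lambda>t. t *\<^sub>R h)) (at 0)"
      by (auto intro!: derivative_eq_intros)
    ultimately have "((\<lambda>t. f (x + t *\<^sub>R h)) has_derivative (\<lambda>t. r \<bullet> (t *\<^sub>R h))) (at 0)"
      using has_derivative_in_compose[of "\<lambda>t. x + t *\<^sub>R h" _ 0 UNIV f] by blast
    then show ?thesis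
      by (simp add: has_field_derivative_def mult_commute_abs)
  qed
  have "p - q \<in> Rn d"
    using assms subspace_Rn by (auto simp: has_gradient_def intro: subspace_diff)
  then have "p \<bullet> (p - q) = q \<bullet> (p - q)"
    using * assms(2,3) DERIV_unique by blast
  then have "(p - q) \<bullet> (p - q) = 0"
    by (simp add: inner_diff_left)
  then show ?thesis by simp
qed

lemma gradient_eq: "x \<in> Rn d \<Longrightarrow> has_gradient d f x p \<Longrightarrow> gradient d f x = p"
  unfolding gradient_def by (blast intro: the_equality has_gradient_unique)

text \<open>The Hessian exists at \<open>x\<close>, as the derivative \<open>H\<close> of the gradient, and is bounded below by
  \<open>c\<close> times the identity in the Loewner order. \<open>H\<close> is determined on \<open>Rn d\<close> and is symmetric
  there, being a second Frechet derivative.\<close>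

definition hessian_ge :: "nat \<Rightarrow> (seq \<Rightarrow> real) \<Rightarrow> seq \<Rightarrow> real \<Rightarrow> bool"
  where "hessian_ge d f x c \<longleftrightarrow>
    (\<exists>H. (gradient d f has_derivative H) (at x within Rn d) \<and>
         (\<forall>h\<in>Rn d. h \<bullet> H h \<ge> c * (h \<bullet> h)))"

definition smooth :: "nat \<Rightarrow> real \<Rightarrow> (seq \<Rightarrow> real) \<Rightarrow> bool"
  where "smooth d L f \<longleftrightarrow>
    (\<forall>x\<in>Rn d. \<exists>p. has_gradient d f x p) \<and> L-lipschitz_on (Rn d) (gradient d f)"


section \<open>Standing assumptions\<close>

definition feasible_set :: "nat \<Rightarrow> nat \<Rightarrow> (nat \<Rightarrow> seq \<Rightarrow> real) \<Rightarrow> seq set"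
  where "feasible_set d m g = {x\<in>Rn d. \<forall>i\<in>{1..m}. g i x \<le> 0}"

definition active :: "nat \<Rightarrow> (nat \<Rightarrow> seq \<Rightarrow> real) \<Rightarrow> seq \<Rightarrow> nat set"
  where "active m g x = {i\<in>{1..m}. g i x \<ge> 0}"

definition assumption_A1 :: "nat \<Rightarrow> (seq \<Rightarrow> seq) \<Rightarrow> real \<Rightarrow> real \<Rightarrow> bool"
  where "assumption_A1 d F R L\<^sub>F \<longleftrightarrow>
    F ` Rn d \<subseteq> Rn d \<and>
    maximal_monotone_operator d F \<and>
    continuous_on (Rn d) F \<and>
    bdd_above ((\<lambda>x. norm (F x)) ` (Rn d \<inter> cball 0 R)) \<and>
    L\<^sub>F = (SUP x\<in>Rn d \<inter> cball 0 R. norm (F x))"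

definition assumption_A2 ::
    "nat \<Rightarrow> nat \<Rightarrow> (nat \<Rightarrow> seq \<Rightarrow> real) \<Rightarrow> real \<Rightarrow> real \<Rightarrow> real \<Rightarrow> bool"
  where "assumption_A2 d m g D L\<^sub>g l\<^sub>g \<longleftrightarrow>
    (\<forall>i\<in>{1..m}. convex_on (Rn d) (g i) \<and> L\<^sub>g-lipschitz_on (Rn d) (g i) \<and> smooth d l\<^sub>g (g i)) \<and>
    feasible_set d m g \<noteq> {} \<and>
    feasible_set d m g \<subseteq> cball 0 D \<and>
    (\<exists>i\<in>{1..m}. \<exists>l\<^sub>0>0. \<exists>U. openin (top_of_set (Rn d)) U \<and>
       top_of_set (Rn d) frontier_of feasible_set d m g \<subseteq> U \<and>
       (\<forall>x\<in>U. hessian_ge d (g i) x l\<^sub>0))"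


section \<open>The algorithm\<close>

definition velocity_set ::
    "nat \<Rightarrow> nat \<Rightarrow> (nat \<Rightarrow> seq \<Rightarrow> real) \<Rightarrow> real \<Rightarrow> real \<Rightarrow> seq \<Rightarrow> seq set"
  where "velocity_set d m g \<alpha> V x =
    {v\<in>Rn d. (\<forall>i\<in>active m g x. \<alpha> * g i x + gradient d (g i) x \<bullet> v \<le> 0) \<and> norm v \<le> V}"

text \<open>\<open>v\<close> minimizes half the squared norm of \<open>w + u\<close> over \<open>w \<in> K\<close> with precision \<open>\<epsilon>\<close>,
  in the variational sense.\<close>

definition approx_minimizer :: "seq set \<Rightarrow> seq \<Rightarrow> real \<Rightarrow> seq \<Rightarrow> bool"
  where "approx_minimizer K u \<epsilon> v \<longleftrightarrow> v \<in> K \<and> (\<forall>w\<in>K. (v + u) \<bullet> (v - w) \<le> \<epsilon> / 2)"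

text \<open>For \<open>y = 0\<close> the value is \<open>0\<close>, as it should be, although \<open>R / norm y\<close> is a division by zero.\<close>

definition project_ball :: "real \<Rightarrow> seq \<Rightarrow> seq"
  where "project_ball R y = min 1 (R / norm y) *\<^sub>R y"

text \<open>The sequences \<open>x\<close>, \<open>v\<close> are the iterates and velocities of some run with horizon \<open>T\<close>, where
  iteration \<open>t\<close> solves its quadratic program with precision \<open>\<epsilon> t\<close>. Neither the starting point nor
  the approximate minimizers are determined, so this is a relation.\<close>

definition opcgm_run ::
    "nat \<Rightarrow> nat \<Rightarrow> (seq \<Rightarrow> seq) \<Rightarrow> (nat \<Rightarrow> seq \<Rightarrow> real) \<Rightarrow> real \<Rightarrow> nat \<Rightarrow>
     (nat \<Rightarrow> real) \<Rightarrow> (nat \<Rightarrow> seq) \<Rightarrow> (nat \<Rightarrow> seq) \<Rightarrow> bool"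
  where "opcgm_run d m F g R T \<epsilon> v x \<longleftrightarrow>
    x 0 \<in> feasible_set d m g \<and>
    (\<forall>t<T.
       let \<alpha> = 1 / sqrt (real t + 1);
           \<eta> = 1 / sqrt (real t + 1);
           V = 4 * norm (F (x t)) + 2 * \<alpha> * R + 1
       in \<epsilon> t \<le> (norm (F (x t)))\<^sup>2 / (real t + 1) \<and>
          approx_minimizer (velocity_set d m g \<alpha> V (x t)) (F (x t)) (\<epsilon> t) (v t) \<and>
          x (Suc t) = project_ball R (x t + \<eta> *\<^sub>R v t))"

definition average :: "nat \<Rightarrow> (nat \<Rightarrow> seq) \<Rightarrow> seq"
  where "average T x = (1 / real T) *\<^sub>R (\<Sum>t<T. x t)"

end

theory Submission
  imports Defs
begin

text \<open>
  The velocity set at \<open>x\<close> is closed under adding \<open>s (z - x)\<close> for feasible \<open>z\<close> and \<open>s \<ge> 0\<close>, as long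
  as the norm bound is respected, because \<open>z - x\<close> does not increase an active constraint to first
  order. Testing the approximate minimality of \<open>v\<close> with \<open>\<alpha> (z - x)\<close> shows that the norm bound is
  slack by at least \<open>1\<close>, so one may test again with \<open>v + s (z - x)\<close> for a fixed \<open>s > 0\<close>. This gives
  \<open>v \<bullet> (x - z) \<le> - F x \<bullet> (x - z) + \<epsilon> / (2 s)\<close>, the inequality of projected subgradient descent up
  to an error \<open>O(1 / t)\<close>, and the usual telescoping argument with steps \<open>1 / sqrt t\<close> yields the gap
  bound. The constraint bound holds with \<open>C\<^sub>3 = 0\<close>: the average stays in the ball of radius \<open>R\<close>, within
  distance \<open>2 R\<close> of a feasible point, and the constraints are Lipschitz.
\<close>

text \<open>Restricting \<open>f\<close> to the line through \<open>x\<close> and \<open>y\<close>,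
  which stays inside \<open>Rn d\<close>, reduces this to the tangent inequality for convex
  functions of one real variable.\<close>

lemma convex_on_gradient_le:
  assumes "convex_on (Rn d) f" "has_gradient d f x p" "x \<in> Rn d" "y \<in> Rn d"
  shows "f x + p \<bullet> (y - x) \<le> f y"
proof -
  define h where "h = y - x"
  have line: "x + t *\<^sub>R h \<in> Rn d" for t
    using assms(3,4) subspace_Rn unfolding h_def
    by (auto intro!: subspace_add subspace_scale subspace_diff)
  have "(f has_derivative (\<lambda>h. p \<bullet> h)) (at (x + 0 *\<^sub>R h) within range (\<lambda>t. x + t *\<^sub>R h))"
    using assms(2) line by (auto simp: has_gradient_def intro: has_derivative_subset)
  moreover have "((\<lambda>t. x + t *\<^sub>R h) has_derivative (\<lambda>t. t *\<^sub>R h)) (at 0)"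
    by (auto intro!: derivative_eq_intros)
  ultimately have "((\<lambda>t. f (x + t *\<^sub>R h)) has_derivative (\<lambda>t. p \<bullet> (t *\<^sub>R h))) (at 0)"
    using has_derivative_in_compose[of "\<lambda>t. x + t *\<^sub>R h" _ 0 UNIV f] by blast
  then have der: "((\<lambda>t. f (x + t *\<^sub>R h)) has_real_derivative p \<bullet> h) (at 0)"
    by (simp add: has_field_derivative_def mult_commute_abs)
  have "convex_on UNIV (\<lambda>t. f (x + t *\<^sub>R h))"
  proof (rule convex_onI)
    fix u a b :: real
    assume u: "0 < u" "u < 1"
    have "x + ((1 - u) *\<^sub>R a + u *\<^sub>R b) *\<^sub>R h = (1 - u) *\<^sub>R (x + a *\<^sub>R h) + u *\<^sub>R (x + b *\<^sub>R h)"
      by (simp add: algebra_simps)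
    then show "f (x + ((1 - u) *\<^sub>R a + u *\<^sub>R b) *\<^sub>R h)
        \<le> (1 - u) * f (x + a *\<^sub>R h) + u * f (x + b *\<^sub>R h)"
      using convex_onD[OF assms(1), of u "x + a *\<^sub>R h" "x + b *\<^sub>R h"] u line by simp
  qed simp
  from convex_on_imp_above_tangent[OF this, of 0 1, simplified, OF der]
  show ?thesis by (simp add: h_def)
qed

lemma project_ball_in_Rn: "y \<in> Rn d \<Longrightarrow> project_ball R y \<in> Rn d"
  unfolding project_ball_def using subspace_Rn by (blast intro: subspace_scale)

lemma norm_project_ball: "0 \<le> R \<Longrightarrow> norm (project_ball R y) \<le> R"
  by (cases "y = 0") (auto simp: project_ball_def min_def field_simps)

text \<open>If \<open>y\<close> lies outside the ball and \<open>c *\<^sub>R y\<close> is its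
  projection, then \<open>y - c *\<^sub>R y\<close> and \<open>c *\<^sub>R y - z\<close> have
  nonnegative inner product, so expanding the square of their sum \<open>y - z\<close> leaves at
  least the square of the second vector.\<close>

lemma norm_project_ball_diff_le:
  assumes "norm z \<le> R"
  shows "norm (project_ball R y - z) \<le> norm (y - z)"
proof (cases "norm y \<le> R")
  case True
  then have "project_ball R y = y"
    by (cases "y = 0") (auto simp: project_ball_def min_def field_simps)
  then show ?thesis by simp
next
  case False
  have "0 \<le> R" using assms norm_ge_zero order_trans by blast
  define c where "c = R / norm y"
  have y: "norm y > 0" using False \<open>0 \<le> R\<close> by linarith
  have c: "0 \<le> c" "c < 1" "c * norm y = R"
    using False \<open>0 \<le> R\<close> y by (auto simp: c_def)
  have p: "project_ball R y = c *\<^sub>R y"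
    using c by (simp add: project_ball_def c_def)
  have "y \<bullet> z \<le> norm y * R"
    using norm_cauchy_schwarz[of y z] mult_left_mono[OF assms norm_ge_zero[of y]] by linarith
  also have "\<dots> = c * (y \<bullet> y)"
    using c(3) by (simp add: power2_norm_eq_inner[symmetric] power2_eq_square mult_ac)
  finally have "0 \<le> (1 - c) * (c * (y \<bullet> y) - y \<bullet> z)"
    using c by simp
  also have "\<dots> = (y - c *\<^sub>R y) \<bullet> (c *\<^sub>R y - z)"
    by (simp add: algebra_simps)
  finally have "0 \<le> (y - c *\<^sub>R y) \<bullet> (c *\<^sub>R y - z)" .
  moreover have "(norm (y - z))\<^sup>2 = (norm (y - c *\<^sub>R y))\<^sup>2 + (norm (c *\<^sub>R y - z))\<^sup>2
      + 2 * ((y - c *\<^sub>R y) \<bullet> (c *\<^sub>R y - z))"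
    unfolding power2_norm_eq_inner by (simp add: inner_diff_left inner_diff_right inner_commute)
  moreover have "0 \<le> (norm (y - c *\<^sub>R y))\<^sup>2" by simp
  ultimately have "(norm (c *\<^sub>R y - z))\<^sup>2 \<le> (norm (y - z))\<^sup>2"
    by linarith
  then show ?thesis
    unfolding p by (rule power2_le_imp_le) simp
qed

text \<open>The constraint value at the combination is \<open>a\<close> times the one at
  \<open>v\<close>, plus \<open>b\<close> times the linearization of \<open>g i\<close> evaluated at
  \<open>z\<close>, plus \<open>(\<alpha> - a * \<alpha> - b) * g i x\<close>. Convexity handles the
  second term; the third is nonpositive because \<open>g i x\<close> is nonnegative for active
  \<open>i\<close>. The cases used are \<open>a = 0\<close>, \<open>b = \<alpha>\<close> and
  \<open>a = 1\<close>, \<open>b = s\<close>.\<close>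

lemma velocity_set_combination:
  assumes conv: "\<And>i. i \<in> {1..m} \<Longrightarrow> convex_on (Rn d) (g i)"
    and grad: "\<And>i. i \<in> {1..m} \<Longrightarrow> has_gradient d (g i) x (gradient d (g i) x)"
    and x: "x \<in> Rn d" and z: "z \<in> feasible_set d m g"
    and v: "v \<in> velocity_set d m g \<alpha> V x"
    and ab: "0 \<le> a" "0 \<le> b" "\<alpha> \<le> a * \<alpha> + b"
    and le: "norm (a *\<^sub>R v + b *\<^sub>R (z - x)) \<le> V"
  shows "a *\<^sub>R v + b *\<^sub>R (z - x) \<in> velocity_set d m g \<alpha> V x"
  unfolding velocity_set_def mem_Collect_eq
proof (intro conjI ballI le)
  show "a *\<^sub>R v + b *\<^sub>R (z - x) \<in> Rn d"
    using x z v subspace_Rn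
    by (auto simp: velocity_set_def feasible_set_def
        intro!: subspace_add subspace_scale subspace_diff)
next
  fix i assume i: "i \<in> active m g x"
  then have i': "i \<in> {1..m}" and gx: "0 \<le> g i x" by (auto simp: active_def)
  define p where "p = gradient d (g i) x"
  have "g i x + p \<bullet> (z - x) \<le> g i z"
    using convex_on_gradient_le[OF conv[OF i'] grad[OF i'] x] z
    by (simp add: p_def feasible_set_def)
  also have "\<dots> \<le> 0" using z i' by (simp add: feasible_set_def)
  finally have "b * (g i x + p \<bullet> (z - x)) \<le> 0"
    using ab by (simp add: mult_nonneg_nonpos)
  moreover have "a * (\<alpha> * g i x + p \<bullet> v) \<le> 0"
    using v i ab by (simp add: velocity_set_def mult_nonneg_nonpos p_def)
  moreover have "(\<alpha> - a * \<alpha> - b) * g i x \<le> 0"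
    using ab gx by (simp add: mult_nonpos_nonneg)
  ultimately show "\<alpha> * g i x + gradient d (g i) x \<bullet> (a *\<^sub>R v + b *\<^sub>R (z - x)) \<le> 0"
    unfolding p_def[symmetric] inner_add_right inner_scaleR_right
    by (simp add: algebra_simps)
qed

text \<open>Cauchy-Schwarz turns the variational inequality into a quadratic inequality in
  \<open>norm v\<close>, which fails beyond the stated bound.\<close>

lemma norm_le_of_approx_minimizer:
  assumes min: "(v + u) \<bullet> (v - w) \<le> \<epsilon> / 2" and \<epsilon>: "\<epsilon> \<le> (norm u)\<^sup>2"
  shows "norm v \<le> 2 * norm u + norm w"
proof (rule ccontr)
  define n f \<omega> where "n = norm v" and "f = norm u" and "\<omega> = norm w"
  assume "\<not> norm v \<le> 2 * norm u + norm w"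
  then have gt: "n > 2 * f + \<omega>" by (simp add: n_def f_def \<omega>_def)
  have pos: "0 \<le> f" "0 \<le> \<omega>" by (auto simp: f_def \<omega>_def)
  have "(v + u) \<bullet> (v - w) = n\<^sup>2 + u \<bullet> v - v \<bullet> w - u \<bullet> w"
    unfolding n_def power2_norm_eq_inner
    by (simp add: inner_add_left inner_diff_right)
  moreover have "u \<bullet> v \<ge> - (f * n)" "v \<bullet> w \<le> n * \<omega>" "u \<bullet> w \<le> f * \<omega>"
    using Cauchy_Schwarz_ineq2[of u v] norm_cauchy_schwarz[of v w] norm_cauchy_schwarz[of u w]
    by (auto simp: n_def f_def \<omega>_def)
  ultimately have "n\<^sup>2 - f * n - n * \<omega> - f * \<omega> \<le> f\<^sup>2 / 2"
    using min \<epsilon> by (simp add: f_def)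
  moreover have "n * (n - f - \<omega>) \<ge> n * f"
    using gt pos by (intro mult_left_mono) auto
  moreover have "n * f \<ge> (2 * f + \<omega>) * f"
    using gt pos by (intro mult_right_mono) auto
  moreover have "n * (n - f - \<omega>) = n\<^sup>2 - f * n - n * \<omega>"
    "(2 * f + \<omega>) * f = 2 * f\<^sup>2 + f * \<omega>"
    by (auto simp: algebra_simps power2_eq_square)
  \<comment> \<open>The product lies between \<open>2 * f\<^sup>2 + f * \<omega>\<close> and
    \<open>f\<^sup>2 / 2 + f * \<omega>\<close>, which forces \<open>f = 0\<close>. In this
    degenerate case the contradiction comes from the strict inequality
    \<open>n > \<omega>\<close>.\<close>
  ultimately have "f\<^sup>2 = 0" and le: "n * (n - f - \<omega>) \<le> f\<^sup>2 / 2 + f * \<omega>"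
    using zero_le_power2[of f] by linarith+
  then have "n * (n - f - \<omega>) \<le> 0" by simp
  moreover have "0 < n * (n - f - \<omega>)"
    using gt pos by (intro mult_pos_pos) auto
  ultimately show False by simp
qed

text \<open>This is summation by parts, done by induction: keeping
  \<open>sqrt (real n) * \<Delta> n / 2\<close> on the left lets each increase of the weight be paid
  for by the bound \<open>M\<close>.\<close>

lemma sum_le_sqrt_of_descent:
  fixes c \<Delta> :: "nat \<Rightarrow> real"
  assumes step: "\<And>t. t < n \<Longrightarrow>
      c t \<le> sqrt (real t + 1) * (\<Delta> t - \<Delta> (Suc t)) / 2 + B / sqrt (real t + 1)"
    and M: "\<And>t. t < n \<Longrightarrow> \<Delta> t \<le> M" and B: "0 \<le> B"
  shows "(\<Sum>t<n. c t) + sqrt (real n) * \<Delta> n / 2 \<le> (M / 2 + 2 * B) * sqrt (real n)"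
  using step M
proof (induction n)
  case (Suc n)
  define r s q where "r = sqrt (real n)" and "s = sqrt (real n + 1)" and "q = B / s"
  have rs: "0 \<le> r" "r \<le> s" "0 < s" "s\<^sup>2 = r\<^sup>2 + 1" by (auto simp: r_def s_def)
  \<comment> \<open>With \<open>s\<^sup>2 = r\<^sup>2 + 1\<close> this yields
    \<open>1 / s \<le> 2 * (s - r)\<close>, so the errors \<open>B / sqrt (real t + 1)\<close>
    telescope to at most \<open>2 * B * sqrt (real n)\<close>.\<close>
  have "0 \<le> (s - r)\<^sup>2" by simp
  then have "1 \<le> 2 * s * (s - r)"
    using rs by (simp add: power2_eq_square algebra_simps)
  then have "1 / s \<le> 2 * (s - r)"
    using rs by (simp add: field_simps)
  then have "q \<le> B * (2 * (s - r))"
    using B mult_left_mono[of "1 / s" "2 * (s - r)" B] by (simp add: q_def)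
  moreover have "(s - r) * \<Delta> n \<le> (s - r) * M"
    using Suc.prems rs by (intro mult_left_mono) auto
  moreover have "(\<Sum>t<n. c t) + r * \<Delta> n / 2 \<le> (M / 2 + 2 * B) * r"
    unfolding r_def using Suc.prems by (intro Suc.IH) auto
  moreover have "c n \<le> s * (\<Delta> n - \<Delta> (Suc n)) / 2 + q"
    unfolding q_def s_def by (rule Suc.prems) simp
  ultimately have "(\<Sum>t<n. c t) + c n + s * \<Delta> (Suc n) / 2 \<le> (M / 2 + 2 * B) * s"
    by (simp add: field_simps)
  then show ?case by (simp add: s_def add.commute)
qed simp

lemma opcgm_run_in_ball:
  assumes run: "opcgm_run d m F g R T \<epsilon> v x"
    and feas: "feasible_set d m g \<subseteq> cball 0 R" and t: "t \<le> T"
  shows "x t \<in> Rn d \<and> norm (x t) \<le> R"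
  using t
proof (induction t)
  case 0
  then show ?case using run feas by (auto simp: opcgm_run_def feasible_set_def)
next
  case (Suc t)
  then have x: "x t \<in> Rn d" "norm (x t) \<le> R" and "t < T" by auto
  then have "v t \<in> Rn d"
    and eq: "x (Suc t) = project_ball R (x t + (1 / sqrt (real t + 1)) *\<^sub>R v t)"
    using run by (auto simp: opcgm_run_def Let_def approx_minimizer_def velocity_set_def)
  then have "x t + (1 / sqrt (real t + 1)) *\<^sub>R v t \<in> Rn d"
    using x subspace_Rn by (blast intro: subspace_add subspace_scale)
  moreover have "0 \<le> R" using x norm_ge_zero order_trans by blast
  ultimately show ?case
    unfolding eq by (simp add: project_ball_in_Rn norm_project_ball)
qed

text \<open>A single \<open>\<alpha>\<close> is both the constraint parameter and the step size. The
  error constant has one contribution from the inexact quadratic program and one from the squared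
  step length.\<close>

lemma opcgm_step:
  assumes conv: "\<And>i. i \<in> {1..m} \<Longrightarrow> convex_on (Rn d) (g i)"
    and grad: "\<And>i. i \<in> {1..m} \<Longrightarrow> has_gradient d (g i) x (gradient d (g i) x)"
    and x: "x \<in> Rn d" "norm x \<le> R" and z: "z \<in> feasible_set d m g" "norm z \<le> R"
    and \<alpha>: "0 < \<alpha>" "\<alpha> \<le> 1"
    and V: "V = 4 * norm u + 2 * \<alpha> * R + 1"
    and \<epsilon>: "\<epsilon> \<le> (norm u)\<^sup>2 * \<alpha>\<^sup>2"
    and min: "approx_minimizer (velocity_set d m g \<alpha> V x) u \<epsilon> v"
    and L: "norm u \<le> L"
  shows "u \<bullet> (x - z) \<le> ((norm (x - z))\<^sup>2 - (norm (project_ball R (x + \<alpha> *\<^sub>R v) - z))\<^sup>2) / (2 * \<alpha>)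
      + ((2 * R + 1) * L\<^sup>2 + (2 * L + 2 * R)\<^sup>2) / 2 * \<alpha>"
proof -
  have v: "v \<in> velocity_set d m g \<alpha> V x"
    and opt: "\<And>w. w \<in> velocity_set d m g \<alpha> V x \<Longrightarrow> (v + u) \<bullet> (v - w) \<le> \<epsilon> / 2"
    using min by (auto simp: approx_minimizer_def)
  have R: "0 \<le> R" using x(2) norm_ge_zero order_trans by blast
  have L0: "0 \<le> L" using L norm_ge_zero order_trans by blast
  have xz: "norm (z - x) \<le> 2 * R" using norm_triangle_ineq4[of z x] x z by linarith
  have "\<alpha> * norm (z - x) \<le> \<alpha> * (2 * R)" using xz \<alpha> by (intro mult_left_mono) auto
  then have w: "norm (\<alpha> *\<^sub>R (z - x)) \<le> 2 * \<alpha> * R" using \<alpha> by (simp add: mult_ac)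
  have "\<alpha>\<^sup>2 \<le> \<alpha>" using \<alpha> by (simp add: power2_eq_square mult_left_le)
  have "(norm u)\<^sup>2 * \<alpha>\<^sup>2 \<le> (norm u)\<^sup>2" using \<alpha> by (simp add: mult_left_le power_le_one)
  then have \<epsilon>': "\<epsilon> \<le> (norm u)\<^sup>2" using \<epsilon> by linarith
  have "norm (0 *\<^sub>R v + \<alpha> *\<^sub>R (z - x)) \<le> V"
    using w norm_ge_zero[of u] unfolding V scaleR_zero_left add_0_left by linarith
  then have "0 *\<^sub>R v + \<alpha> *\<^sub>R (z - x) \<in> velocity_set d m g \<alpha> V x"
    using \<alpha> by (intro velocity_set_combination conv grad x z v) auto
  then have "norm v \<le> 2 * norm u + norm (\<alpha> *\<^sub>R (z - x))"
    using opt \<epsilon>' by (intro norm_le_of_approx_minimizer) auto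
  then have nv: "norm v \<le> 2 * norm u + 2 * \<alpha> * R" using w by linarith
  \<comment> \<open>The bound on \<open>norm v\<close> is below \<open>V\<close> by at least 1, so a
    move of length at most 1 is allowed. As \<open>norm (z - x)\<close> is at most
    \<open>2 * R\<close>, this \<open>s\<close> achieves that, also for \<open>R = 0\<close>. It
    does not shrink with \<open>\<alpha>\<close>, hence dividing by it costs only a constant
    factor.\<close>
  define s where "s = 1 / (2 * R + 1)"
  have s: "0 < s" using R by (simp add: s_def)
  have "s * norm (z - x) \<le> 1" using xz R by (simp add: s_def field_simps)
  then have "norm (s *\<^sub>R (z - x)) \<le> 1" using s by simp
  then have "norm (1 *\<^sub>R v + s *\<^sub>R (z - x)) \<le> V"
    using norm_triangle_ineq[of v "s *\<^sub>R (z - x)"] nv norm_ge_zero[of u]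
    unfolding V scaleR_one by linarith
  then have "1 *\<^sub>R v + s *\<^sub>R (z - x) \<in> velocity_set d m g \<alpha> V x"
    using s by (intro velocity_set_combination conv grad x z v) auto
  from opt[OF this] have "(v + u) \<bullet> (s *\<^sub>R (x - z)) \<le> \<epsilon> / 2"
    by (simp add: scaleR_diff_right)
  then have "s * ((v + u) \<bullet> (x - z)) \<le> \<epsilon> / 2"
    unfolding inner_scaleR_right .
  then have "(v + u) \<bullet> (x - z) \<le> (2 * R + 1) * \<epsilon> / 2"
    unfolding s_def using R by (simp add: pos_divide_le_eq mult_ac)
  \<comment> \<open>The precision is of order \<open>\<alpha>\<^sup>2\<close>; weakening it to order
    \<open>\<alpha>\<close> allows merging it with the error from the squared step.\<close>
  also have "\<dots> \<le> (2 * R + 1) * (L\<^sup>2 * \<alpha>) / 2"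
  proof -
    have "(norm u)\<^sup>2 * \<alpha>\<^sup>2 \<le> L\<^sup>2 * \<alpha>"
      using \<open>\<alpha>\<^sup>2 \<le> \<alpha>\<close> L by (intro mult_mono power_mono) auto
    then show ?thesis
      using \<epsilon> R by (intro divide_right_mono mult_left_mono) auto
  qed
  finally have 1: "u \<bullet> (x - z) \<le> - (v \<bullet> (x - z)) + (2 * R + 1) * L\<^sup>2 / 2 * \<alpha>"
    by (simp add: inner_add_left field_simps)
  have "\<alpha> * R \<le> R" using \<alpha> R by (simp add: mult_left_le_one_le)
  then have "(norm v)\<^sup>2 \<le> (2 * L + 2 * R)\<^sup>2"
    using nv L by (intro power_mono) auto
  then have 2: "\<alpha> * (norm v)\<^sup>2 / 2 \<le> (2 * L + 2 * R)\<^sup>2 / 2 * \<alpha>"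
    using \<alpha> by simp
  have "(norm (project_ball R (x + \<alpha> *\<^sub>R v) - z))\<^sup>2 \<le> (norm (x + \<alpha> *\<^sub>R v - z))\<^sup>2"
    using z by (intro power_mono norm_project_ball_diff_le) auto
  also have "\<dots> = (norm (x - z))\<^sup>2 + 2 * \<alpha> * (v \<bullet> (x - z)) + \<alpha>\<^sup>2 * (norm v)\<^sup>2"
    unfolding power2_norm_eq_inner
    by (simp add: inner_commute algebra_simps power2_eq_square)
  finally have "- (v \<bullet> (x - z)) \<le>
      ((norm (x - z))\<^sup>2 - (norm (project_ball R (x + \<alpha> *\<^sub>R v) - z))\<^sup>2) / (2 * \<alpha>) + \<alpha> * (norm v)\<^sup>2 / 2"
    using \<alpha> by (simp add: field_simps power2_eq_square)
  with 1 2 show ?thesis by (simp add: algebra_simps add_divide_distrib)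
qed

theorem theorem6p1:
  fixes R L\<^sub>F L\<^sub>g l\<^sub>g :: real
  shows "\<exists>C\<^sub>1 C\<^sub>2 C\<^sub>3 :: real.
    \<forall>(d::nat) (m::nat) (F :: seq \<Rightarrow> seq) (g :: nat \<Rightarrow> seq \<Rightarrow> real) (D::real).
      d \<ge> 1 \<and> assumption_A1 d F R L\<^sub>F \<and> assumption_A2 d m g D L\<^sub>g l\<^sub>g \<and>
      monotone_operator d F \<and> R \<ge> D \<longrightarrow>
      (\<forall>T \<epsilon> v x. T \<ge> 2 \<and> opcgm_run d m F g R T \<epsilon> v x \<longrightarrow>
        (\<forall>z\<in>feasible_set d m g. F z \<bullet> (average T x - z) \<le> C\<^sub>1 / sqrt (real T)) \<and>
        Max ((\<lambda>i. g i (average T x)) ` {1..m}) \<le> C\<^sub>2 + C\<^sub>3 / sqrt (real T))"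
proof -
  \<comment> \<open>\<open>B\<close> is the error constant of \<open>opcgm_step\<close> with
    \<open>L = L\<^sub>F\<close>, and \<open>C\<close> is the constant of
    \<open>sum_le_sqrt_of_descent\<close> with \<open>M = (2 * R)\<^sup>2\<close>, the squared
    diameter of the ball. Both are fixed before the dimension, the problem data and the
    horizon.\<close>
  define B where "B = ((2 * R + 1) * L\<^sub>F\<^sup>2 + (2 * L\<^sub>F + 2 * R)\<^sup>2) / 2"
  define C where "C = (2 * R)\<^sup>2 / 2 + 2 * B"
  have "(\<forall>z\<in>feasible_set d m g. F z \<bullet> (average T x - z) \<le> C / sqrt (real T)) \<and>
        Max ((\<lambda>i. g i (average T x)) ` {1..m}) \<le> 2 * R * L\<^sub>g + 0 / sqrt (real T)"
    if A1: "assumption_A1 d F R L\<^sub>F" and A2: "assumption_A2 d m g D L\<^sub>g l\<^sub>g"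
      and mono: "monotone_operator d F" and D: "D \<le> R"
      and T: "2 \<le> T" and run: "opcgm_run d m F g R T \<epsilon> v x"
    for d m F g D T \<epsilon> v x
  proof -
    have conv: "convex_on (Rn d) (g i)" and lip: "L\<^sub>g-lipschitz_on (Rn d) (g i)"
      and smooth: "smooth d l\<^sub>g (g i)" if "i \<in> {1..m}" for i
      using A2 that by (auto simp: assumption_A2_def)
    have grad: "has_gradient d (g i) y (gradient d (g i) y)" if "i \<in> {1..m}" "y \<in> Rn d" for i y
      using smooth[OF that(1)] that(2) gradient_eq unfolding smooth_def by metis
    \<comment> \<open>The constraint with a Hessian lower bound supplies an index, so the maximum is
      taken over a nonempty set.\<close>
    have m: "{1..m} \<noteq> {}" using A2 by (auto simp: assumption_A2_def)
    have feas: "feasible_set d m g \<subseteq> cball 0 R"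
      using A2 D by (force simp: assumption_A2_def)
    have x: "x t \<in> Rn d" "norm (x t) \<le> R" if "t \<le> T" for t
      using opcgm_run_in_ball[OF run feas that] by auto
    have R: "0 \<le> R" using x(2)[of 0] norm_ge_zero order_trans by blast
    have B: "0 \<le> B" using R by (simp add: B_def)
    have F_le: "norm (F y) \<le> L\<^sub>F" if "y \<in> Rn d" "norm y \<le> R" for y
      using A1 that unfolding assumption_A1_def by (auto intro!: cSUP_upper)
    have step: "F z \<bullet> (x t - z) \<le>
        sqrt (real t + 1) * ((norm (x t - z))\<^sup>2 - (norm (x (Suc t) - z))\<^sup>2) / 2 + B / sqrt (real t + 1)"
      if t: "t < T" and z: "z \<in> feasible_set d m g" for t z
    proof -
      define \<alpha> where "\<alpha> = 1 / sqrt (real t + 1)"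
      have \<alpha>: "0 < \<alpha>" "\<alpha> \<le> 1" "\<alpha>\<^sup>2 = 1 / (real t + 1)"
        by (auto simp: \<alpha>_def power_divide)
      have alg: "\<epsilon> t \<le> (norm (F (x t)))\<^sup>2 * \<alpha>\<^sup>2"
        "approx_minimizer (velocity_set d m g \<alpha> (4 * norm (F (x t)) + 2 * \<alpha> * R + 1) (x t))
          (F (x t)) (\<epsilon> t) (v t)"
        "x (Suc t) = project_ball R (x t + \<alpha> *\<^sub>R v t)"
        using run t unfolding opcgm_run_def Let_def \<alpha>(3) by (auto simp: \<alpha>_def)
      have z': "z \<in> Rn d" "norm z \<le> R" using z feas by (auto simp: feasible_set_def)
      \<comment> \<open>Monotonicity replaces \<open>F (x t)\<close> by the fixed vector
        \<open>F z\<close>. The gap becomes affine in \<open>x t\<close>, so its mean over the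
        iterates is the gap at the average.\<close>
      have "(F (x t) - F z) \<bullet> (x t - z) \<ge> 0"
        using mono x(1)[of t] z' t by (simp add: monotone_operator_def)
      then have "F z \<bullet> (x t - z) \<le> F (x t) \<bullet> (x t - z)"
        by (simp add: inner_diff_left)
      also have "\<dots> \<le> ((norm (x t - z))\<^sup>2 - (norm (x (Suc t) - z))\<^sup>2) / (2 * \<alpha>) + B * \<alpha>"
        unfolding alg(3) B_def using x[of t] t z z' \<alpha> alg F_le
        by (intro opcgm_step[where \<epsilon> = "\<epsilon> t" and m = m and d = d and g = g, OF conv grad]) auto
      finally show ?thesis by (simp add: \<alpha>_def mult.commute)
    qed
    have avg: "average T x \<in> Rn d" "norm (average T x) \<le> R"
    proof -
      have "(\<Sum>t<T. x t) \<in> Rn d" using x subspace_Rn by (auto intro!: subspace_sum)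
      then show "average T x \<in> Rn d"
        unfolding average_def using subspace_Rn by (blast intro: subspace_scale)
      have "norm (\<Sum>t<T. x t) \<le> (\<Sum>t<T. R)" using x by (intro sum_norm_le) auto
      then show "norm (average T x) \<le> R"
        using T by (simp add: average_def field_simps)
    qed
    show ?thesis
    proof (intro conjI ballI)
      fix z assume z: "z \<in> feasible_set d m g"
      then have z': "norm z \<le> R" using feas by auto
      have dist: "(norm (x t - z))\<^sup>2 \<le> (2 * R)\<^sup>2" if "t < T" for t
        using norm_triangle_ineq4[of "x t" z] x(2)[of t] z' that by (intro power_mono) auto
      have "(\<Sum>t<T. F z \<bullet> (x t - z)) + sqrt (real T) * (norm (x T - z))\<^sup>2 / 2 \<le> C * sqrt (real T)"
        unfolding C_def by (rule sum_le_sqrt_of_descent) (use step z dist B in auto)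
      moreover have "0 \<le> sqrt (real T) * (norm (x T - z))\<^sup>2 / 2" by simp
      ultimately have sum: "(\<Sum>t<T. F z \<bullet> (x t - z)) \<le> C * sqrt (real T)" by linarith
      have "average T x - z = (1 / real T) *\<^sub>R (\<Sum>t<T. x t - z)"
        using T by (simp add: average_def sum_subtractf scaleR_diff_right sum_constant_scaleR
            del: sum_constant)
      then have "F z \<bullet> (average T x - z) = (\<Sum>t<T. F z \<bullet> (x t - z)) / real T"
        by (simp add: inner_sum_right)
      also have "\<dots> \<le> C * sqrt (real T) / real T"
        using sum by (rule divide_right_mono) simp
      also have "\<dots> = C / sqrt (real T)"
        using T by (simp add: field_simps)
      finally show "F z \<bullet> (average T x - z) \<le> C / sqrt (real T)" .
    next
      \<comment> \<open>The starting point \<open>x 0\<close> is the feasible point used for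
        comparison.\<close>
      have "g i (average T x) \<le> 2 * R * L\<^sub>g" if i: "i \<in> {1..m}" for i
      proof -
        have x0: "g i (x 0) \<le> 0" using run i by (auto simp: opcgm_run_def feasible_set_def)
        have "norm (average T x - x 0) \<le> 2 * R"
          using norm_triangle_ineq4[of "average T x" "x 0"] avg x(2)[of 0] by auto
        then have "L\<^sub>g * dist (average T x) (x 0) \<le> L\<^sub>g * (2 * R)"
          using lipschitz_on_nonneg[OF lip[OF i]] by (auto simp: dist_norm intro: mult_left_mono)
        then have "dist (g i (average T x)) (g i (x 0)) \<le> 2 * R * L\<^sub>g"
          using lipschitz_onD[OF lip[OF i] avg(1) x(1)[of 0]] by (simp add: mult_ac)
        then show ?thesis using x0 by (simp add: dist_real_def)
      qed
      then show "Max ((\<lambda>i. g i (average T x)) ` {1..m}) \<le> 2 * R * L\<^sub>g + 0 / sqrt (real T)"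
        using m by simp
    qed
  qed
  then show ?thesis by blast
qed

end
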